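(* Let $n\ge 1$ and $\rho_0,\rho_1 \in (-1,1)$. Let $f,g:\mathbb{F}_2^n\to\{\pm 1\}$ be unbiased Boolean functions, i.e., $\widehat{f}(\emptyset)=\widehat{g}(\emptyset)=0$. Then $$D\big(P_{f(X^n)g(Y^n),\rho_0} \,\big\|\, P_{f(X^n)g(Y^n),\rho_1}\big) \le \max_{1 \le k \le n} d\bigg(\frac{1+\rho_0^k}{2} \,\bigg\|\, \frac{1+\rho_1^k}{2}\bigg).$$
   Context: $\mathbb{F}_2=\{0,1\}$. For $\rho\in[-1,1]$, a pair $(X^n,Y^n)$ of random vectors in $\mathbb{F}_2^n$ is called $\rho$-correlated if $X^n$ is uniform on $\mathbb{F}_2^n$ and, independently for each $i\in\{1,\dots,n\}$, $Y_i=X_i$ with probability $\frac{1+\rho}{2}$ and $Y_i=X_i+1$ with probability $\frac{1-\rho}{2}$. For functions $f,g:\mathbb{F}_2^n\to\{\pm1\}$, $P_{f(X^n)g(Y^n),\rho}$ denotes the joint distribution on $\{\pm1\}^2$ of $(f(X^n),g(Y^n))$ when $(X^n,Y^n)$ is $\rho$-correlated. $\widehat{f}(\emptyset)=\mathbb{E}[f(X^n)]=2^{-n}\sum_{\bm{x}\in\mathbb{F}_2^n} f(\bm{x})$. $D(P\|Q)=\sum_z P(z)\ln\frac{P(z)}{Q(z)}$ is the Kullback-Leibler divergence (with the usual convention that terms with $P(z)=0$ are $0$), and $d(p\|q)=p\ln\frac{p}{q}+(1-p)\ln\frac{1-p}{1-q}$ is the binary divergence. *)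

theory Defs
  imports "HOL-Probability.Probability" "HOL-Library.Z2"
begin

instance bit :: finite
proof
  have "(UNIV :: bit set) \<subseteq> {0, 1}"
    using bit_not_one_iff by blast
  then show "finite (UNIV :: bit set)"
    by (rule finite_subset) simp
qed

text \<open>
  The space $\mathbb{F}_2^n$ is \<^typ>\<open>bit ^ 'n\<close> with $n$ = \<^term>\<open>CARD('n)\<close>. For
  \<open>\<rho>\<close> outside $[-1,1]$ the parameter of \<^const>\<open>bernoulli_pmf\<close> is clamped to $[0,1]$.
\<close>

definition correlated_pair :: "real \<Rightarrow> ((bit ^ 'n) \<times> (bit ^ 'n)) pmf" where
  "correlated_pair \<rho> = do {
     x \<leftarrow> pmf_of_set UNIV;
     y \<leftarrow> Pi_pmf UNIV 0
       (\<lambda>i. map_pmf (\<lambda>same. if same then x $ i else x $ i + 1) (bernoulli_pmf ((1 + \<rho>) / 2)));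
     return_pmf (x, \<chi> i. y i)
   }"

definition joint_pmf ::
    "(bit ^ 'n \<Rightarrow> int) \<Rightarrow> (bit ^ 'n \<Rightarrow> int) \<Rightarrow> real \<Rightarrow> (int \<times> int) pmf" where
  "joint_pmf f g \<rho> = map_pmf (\<lambda>(x, y). (f x, g y)) (correlated_pair \<rho>)"

definition fourier_empty :: "(bit ^ 'n \<Rightarrow> int) \<Rightarrow> real" where
  "fourier_empty f = (\<Sum>x\<in>UNIV. real_of_int (f x)) / 2 ^ CARD('n)"

text \<open>
  \<^const>\<open>KL_divergence\<close> takes the reference measure first, so $D(P\|Q)$ swaps the arguments.
  It is real-valued, hence meaningful only if $P$ is absolutely continuous with respect to $Q$;
  the lemmas below show that this holds for the distributions considered here and that the
  divergence is then the usual sum.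
\<close>

definition KL_pmf :: "'a pmf \<Rightarrow> 'a pmf \<Rightarrow> real" where
  "KL_pmf P Q = KL_divergence (exp 1) (measure_pmf Q) (measure_pmf P)"

definition binary_KL :: "real \<Rightarrow> real \<Rightarrow> real" where
  "binary_KL p q = p * ln (p / q) + (1 - p) * ln ((1 - p) / (1 - q))"

lemma KL_pmf_eq_sum:
  fixes P Q :: "'a :: countable pmf"
  assumes "finite (set_pmf P)" and "set_pmf P \<subseteq> set_pmf Q"
  shows "KL_pmf P Q = (\<Sum>z\<in>set_pmf P. pmf P z * ln (pmf P z / pmf Q z))"
proof -
  interpret sigma_finite_measure "count_space (UNIV :: 'a set)"
    by (rule sigma_finite_measure_count_space)
  have "KL_pmf P Q = (\<integral>z. pmf P z * log (exp 1) (pmf P z / pmf Q z) \<partial>count_space UNIV)"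
    unfolding KL_pmf_def measure_pmf_eq_density[of P] measure_pmf_eq_density[of Q]
    using assms(2) by (intro KL_density_density) (auto simp: pmf_eq_0_set_pmf)
  also have "\<dots> = (\<integral>z. ln (pmf P z / pmf Q z) \<partial>measure_pmf P)"
    unfolding measure_pmf_eq_density[of P]
    by (subst integral_real_density) (auto simp: log_def)
  also have "\<dots> = (\<Sum>z\<in>set_pmf P. pmf P z * ln (pmf P z / pmf Q z))"
    using assms(1) by (subst integral_measure_pmf_real[of "set_pmf P"]) (auto simp: mult.commute)
  finally show ?thesis .
qed

lemma set_correlated_pair:
  assumes "\<rho> \<in> {-1<..<1}"
  shows "set_pmf (correlated_pair \<rho> :: ((bit ^ 'n) \<times> (bit ^ 'n)) pmf) = UNIV"
proof -
  have bern: "set_pmf (bernoulli_pmf ((1 + \<rho>) / 2)) = UNIV"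
    using assms by (intro set_pmf_bernoulli) auto
  have "b \<in> range (\<lambda>same. if same then a else a + 1)" for a b :: bit
  proof -
    have "b = (if b = a then a else a + 1)"
      by (cases a; cases b) auto
    then show ?thesis by blast
  qed
  then have full: "set_pmf (map_pmf (\<lambda>same. if same then a else a + 1)
      (bernoulli_pmf ((1 + \<rho>) / 2))) = UNIV" for a :: bit
    unfolding set_map_pmf bern by blast
  have "(x, y) \<in> set_pmf (correlated_pair \<rho>)" for x y :: "bit ^ 'n"
  proof -
    have "($) y \<in> set_pmf (Pi_pmf UNIV 0 (\<lambda>i. map_pmf (\<lambda>same. if same then x $ i else x $ i + 1)
        (bernoulli_pmf ((1 + \<rho>) / 2))))"
      unfolding set_Pi_pmf[OF finite_class.finite_UNIV] o_def full by (auto simp: PiE_dflt_def)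
    then show ?thesis
      unfolding correlated_pair_def by (auto simp: set_pmf_of_set intro!: bexI[of _ "($) y"])
  qed
  then show ?thesis by auto
qed

lemma set_joint_pmf:
  assumes "\<rho> \<in> {-1<..<1}"
  shows "set_pmf (joint_pmf f g \<rho>) = range f \<times> range g"
  unfolding joint_pmf_def using set_correlated_pair[OF assms] by (auto simp: image_iff)

lemma KL_pmf_joint_pmf:
  assumes "\<rho>\<^sub>0 \<in> {-1<..<1}" and "\<rho>\<^sub>1 \<in> {-1<..<1}"
  shows "KL_pmf (joint_pmf f g \<rho>\<^sub>0) (joint_pmf f g \<rho>\<^sub>1) =
    (\<Sum>z\<in>range f \<times> range g. pmf (joint_pmf f g \<rho>\<^sub>0) z *
      ln (pmf (joint_pmf f g \<rho>\<^sub>0) z / pmf (joint_pmf f g \<rho>\<^sub>1) z))"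
  using KL_pmf_eq_sum[of "joint_pmf f g \<rho>\<^sub>0" "joint_pmf f g \<rho>\<^sub>1"]
  unfolding set_joint_pmf[OF assms(1)] set_joint_pmf[OF assms(2)] by simp

end

(*
  If f and g are unbiased then P(f(X) = a, g(Y) = b) = (1 + a b theta) / 4 with
  theta = E[f(X) g(Y)], so the divergence is d((1 + theta0)/2 || (1 + theta1)/2).
  Expanding the law of (X, Y) in characters gives theta = sum_S f^(S) g^(S) rho^|S|, where
  the empty set does not contribute and sum_S |f^(S) g^(S)| <= 1 by Parseval.  Hence
  (theta0, theta1) lies in the absolutely convex hull of the points (rho0^k, rho1^k), k >= 1.
  The function (s, t) |-> d((1 + s)/2 || (1 + t)/2) is jointly convex, even and zero at the
  origin, so it is at most its maximum over these points.
*)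
theory Submission
  imports Defs
begin

section \<open>Convexity of the binary divergence\<close>

text \<open>This is ln z <= z - 1 at z = a * y / x. The right side is linear in (x, y), with
  equality at x = a * y, so it gives the supporting planes of x * ln (x / y).\<close>

lemma mult_ln_ge:
  fixes x y a :: real
  assumes "x > 0" "y > 0" "a > 0"
  shows "x * ln (x / y) \<ge> x * ln a + x - y * a"
proof -
  have "ln (a * y / x) \<le> a * y / x - 1"
    using assms by (intro ln_le_minus_one) simp
  moreover have "ln (a * y / x) = ln a - ln (x / y)"
    using assms by (simp add: ln_mult ln_div)
  ultimately have "x * (ln a - ln (x / y)) \<le> x * (a * y / x - 1)"
    using assms by (intro mult_left_mono) auto
  also have "\<dots> = a * y - x"
    using assms by (simp add: field_simps)
  finally show ?thesis
    by (simp add: algebra_simps)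
qed

lemma binary_KL_half:
  "binary_KL ((1 + s) / 2) ((1 + t) / 2) =
     ((1 + s) * ln ((1 + s) / (1 + t)) + (1 - s) * ln ((1 - s) / (1 - t))) / 2"
proof -
  have compl: "1 - (1 + u) / 2 = (1 - u) / 2" for u :: real
    by (simp add: field_simps)
  have halves: "x / 2 / (y / 2) = x / y" for x y :: real
    by simp
  show ?thesis
    unfolding binary_KL_def compl halves times_divide_eq_left by (rule add_divide_distrib[symmetric])
qed

lemma binary_KL_half_uminus:
  "binary_KL ((1 + - s) / 2) ((1 + - t) / 2) = binary_KL ((1 + s) / 2) ((1 + t) / 2)"
  unfolding binary_KL_half by simp

text \<open>Joint convexity, stated as an affine minorant that is exact at (u, v); it is the average
  of two instances of \<open>mult_ln_ge\<close>.\<close>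

lemma binary_KL_half_support:
  assumes "\<bar>u\<bar> < 1" "\<bar>v\<bar> < 1"
  obtains c \<alpha> \<beta> where
    "binary_KL ((1 + u) / 2) ((1 + v) / 2) = c + \<alpha> * u + \<beta> * v"
    "\<And>s t. \<bar>s\<bar> < 1 \<Longrightarrow> \<bar>t\<bar> < 1 \<Longrightarrow> c + \<alpha> * s + \<beta> * t \<le> binary_KL ((1 + s) / 2) ((1 + t) / 2)"
proof -
  \<comment> \<open>The ratios at (u, v) are the parameters for which both instances become
    equalities there; \<open>c\<close>, \<open>\<alpha>\<close> and \<open>\<beta>\<close> below
    collect the resulting coefficients.\<close>
  define a where "a = (1 + u) / (1 + v)"
  define b where "b = (1 - u) / (1 - v)"
  have ab: "a > 0" "b > 0" "a * (1 + v) = 1 + u" "b * (1 - v) = 1 - u"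
    using assms by (auto simp: a_def b_def)
  define c where "c = (ln a + ln b) / 2 + 1 - (a + b) / 2"
  define \<alpha> where "\<alpha> = (ln a - ln b) / 2"
  define \<beta> where "\<beta> = (b - a) / 2"
  have affine: "c + \<alpha> * s + \<beta> * t =
      (((1 + s) * ln a + (1 + s) - (1 + t) * a) + ((1 - s) * ln b + (1 - s) - (1 - t) * b)) / 2" for s t
    unfolding c_def \<alpha>_def \<beta>_def by (simp add: field_simps)
  show ?thesis
  proof
    show "binary_KL ((1 + u) / 2) ((1 + v) / 2) = c + \<alpha> * u + \<beta> * v"
      unfolding binary_KL_half affine a_def[symmetric] b_def[symmetric]
      using ab(3,4) by (simp add: mult.commute)
    show "c + \<alpha> * s + \<beta> * t \<le> binary_KL ((1 + s) / 2) ((1 + t) / 2)"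
      if "\<bar>s\<bar> < 1" "\<bar>t\<bar> < 1" for s t
      unfolding binary_KL_half affine
      using mult_ln_ge[of "1 + s" "1 + t" a] mult_ln_ge[of "1 - s" "1 - t" b] ab that
      by (simp add: abs_less_iff)
  qed
qed

lemma binary_KL_half_nonneg:
  assumes "\<bar>s\<bar> < 1" "\<bar>t\<bar> < 1"
  shows "binary_KL ((1 + s) / 2) ((1 + t) / 2) \<ge> 0"
  unfolding binary_KL_half
  using mult_ln_ge[of "1 + s" "1 + t" 1] mult_ln_ge[of "1 - s" "1 - t" 1] assms
  by (simp add: abs_less_iff)

text \<open>Keeps the combined point in the open square where supports exist. Any nonzero weight
  makes the bound by the total weight strict.\<close>

lemma abs_sum_mult_less_1:
  fixes w s :: "'a \<Rightarrow> real"
  assumes "finite I" "\<And>i. i \<in> I \<Longrightarrow> \<bar>s i\<bar> < 1" "(\<Sum>i\<in>I. \<bar>w i\<bar>) \<le> 1"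
  shows "\<bar>\<Sum>i\<in>I. w i * s i\<bar> < 1"
proof (cases "\<forall>i\<in>I. w i = 0")
  case False
  then obtain j where j: "j \<in> I" "w j \<noteq> 0" by blast
  have "\<bar>\<Sum>i\<in>I. w i * s i\<bar> \<le> (\<Sum>i\<in>I. \<bar>w i\<bar> * \<bar>s i\<bar>)"
    using sum_abs[of "\<lambda>i. w i * s i" I] by (simp add: abs_mult)
  also have "\<dots> < (\<Sum>i\<in>I. \<bar>w i\<bar>)"
  proof (rule sum_strict_mono_ex1)
    show "\<forall>i\<in>I. \<bar>w i\<bar> * \<bar>s i\<bar> \<le> \<bar>w i\<bar>"
      using assms(2) by (auto intro!: mult_left_le intro: less_imp_le)
    show "\<exists>i\<in>I. \<bar>w i\<bar> * \<bar>s i\<bar> < \<bar>w i\<bar>"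
      using j assms(2)[of j] by (intro bexI[of _ j]) auto
  qed fact
  finally show ?thesis using assms(3) by simp
qed simp

text \<open>The minorant supporting at the combined point is compared with \<open>M\<close> at each
  given point and, by evenness, at its mirror image, which covers negative weights. Weight missing
  from 1 sits at the origin, where the divergence is 0.\<close>

lemma binary_KL_half_abs_convex:
  fixes w s t :: "'a \<Rightarrow> real"
  assumes fin: "finite I" and s: "\<And>i. i \<in> I \<Longrightarrow> \<bar>s i\<bar> < 1" and t: "\<And>i. i \<in> I \<Longrightarrow> \<bar>t i\<bar> < 1"
    and w: "(\<Sum>i\<in>I. \<bar>w i\<bar>) \<le> 1" and "M \<ge> 0"
    and M: "\<And>i. i \<in> I \<Longrightarrow> binary_KL ((1 + s i) / 2) ((1 + t i) / 2) \<le> M"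
  shows "binary_KL ((1 + (\<Sum>i\<in>I. w i * s i)) / 2) ((1 + (\<Sum>i\<in>I. w i * t i)) / 2) \<le> M"
proof -
  define u where "u = (\<Sum>i\<in>I. w i * s i)"
  define v where "v = (\<Sum>i\<in>I. w i * t i)"
  have uv: "\<bar>u\<bar> < 1" "\<bar>v\<bar> < 1"
    unfolding u_def v_def using abs_sum_mult_less_1 fin s t w by blast+
  obtain c \<alpha> \<beta> where eq: "binary_KL ((1 + u) / 2) ((1 + v) / 2) = c + \<alpha> * u + \<beta> * v"
    and le: "\<And>s t. \<bar>s\<bar> < 1 \<Longrightarrow> \<bar>t\<bar> < 1 \<Longrightarrow> c + \<alpha> * s + \<beta> * t \<le> binary_KL ((1 + s) / 2) ((1 + t) / 2)"
    using binary_KL_half_support[OF uv] by blast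
  have "c \<le> 0"
    using le[of 0 0] by (simp add: binary_KL_def)
  have term_le: "w i * (\<alpha> * s i + \<beta> * t i) \<le> \<bar>w i\<bar> * (M - c)" if i: "i \<in> I" for i
  proof -
    have "\<alpha> * s i + \<beta> * t i \<le> M - c"
      using le[OF s[OF i] t[OF i]] M[OF i] by linarith
    moreover have "- (\<alpha> * s i + \<beta> * t i) \<le> M - c"
      using le[of "- s i" "- t i"] s[OF i] t[OF i] M[OF i] binary_KL_half_uminus[of "s i" "t i"] by simp
    ultimately have "\<bar>\<alpha> * s i + \<beta> * t i\<bar> \<le> M - c"
      by (simp add: abs_le_iff)
    then have "\<bar>w i\<bar> * \<bar>\<alpha> * s i + \<beta> * t i\<bar> \<le> \<bar>w i\<bar> * (M - c)"
      by (intro mult_left_mono) auto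
    then show ?thesis
      using abs_ge_self[of "w i * (\<alpha> * s i + \<beta> * t i)"] by (simp add: abs_mult)
  qed
  have "c + \<alpha> * u + \<beta> * v = c + (\<Sum>i\<in>I. w i * (\<alpha> * s i + \<beta> * t i))"
    unfolding u_def v_def by (simp add: sum_distrib_left sum.distrib algebra_simps)
  also have "\<dots> \<le> c + (\<Sum>i\<in>I. \<bar>w i\<bar> * (M - c))"
    by (intro add_left_mono sum_mono term_le)
  also have "\<dots> = c + (\<Sum>i\<in>I. \<bar>w i\<bar>) * (M - c)"
    by (simp add: sum_distrib_right)
  \<comment> \<open>Raising the total weight to 1 is harmless because c <= 0 <= M.\<close>
  also have "\<dots> \<le> c + 1 * (M - c)"
    using w \<open>c \<le> 0\<close> \<open>M \<ge> 0\<close> by (intro add_left_mono mult_right_mono) auto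
  finally show ?thesis
    unfolding u_def[symmetric] v_def[symmetric] eq by simp
qed

section \<open>Fourier analysis on the hypercube\<close>

definition bit_sign :: "bit \<Rightarrow> real" where
  "bit_sign b = (if b = 0 then 1 else -1)"

text \<open>The Walsh character of S, that is, (-1) to the sum of the coordinates in S.\<close>

definition hypercube_char :: "'n set \<Rightarrow> bit ^ 'n \<Rightarrow> real" where
  "hypercube_char S x = (\<Prod>i\<in>S. bit_sign (x $ i))"

definition fourier_coeff :: "(bit ^ 'n \<Rightarrow> real) \<Rightarrow> 'n set \<Rightarrow> real" where
  "fourier_coeff F S = (\<Sum>x\<in>UNIV. F x * hypercube_char S x) / 2 ^ CARD('n)"

lemma card_bit: "CARD(bit) = 2"
proof -
  have "(UNIV :: bit set) = {0, 1}"
    using bit_not_one_iff by blast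
  then have "CARD(bit) = card {0, 1 :: bit}"
    by (rule arg_cong)
  then show ?thesis by simp
qed

text \<open>Expanding the product, S records the coordinates at which the second summand is
  chosen.\<close>

lemma sum_hypercube_char:
  fixes x y :: "bit ^ 'n"
  shows "(\<Sum>S\<in>UNIV. \<rho> ^ card S * (hypercube_char S x * hypercube_char S y)) =
    (\<Prod>i\<in>UNIV. 1 + \<rho> * (bit_sign (x $ i) * bit_sign (y $ i)))"
proof -
  have "(\<Prod>i\<in>UNIV. \<rho> * (bit_sign (x $ i) * bit_sign (y $ i)) + 1) =
      (\<Sum>S\<in>Pow UNIV. (\<Prod>i\<in>S. \<rho> * (bit_sign (x $ i) * bit_sign (y $ i))) * (\<Prod>i\<in>UNIV - S. 1))"
    by (intro prod_add) auto
  then show ?thesis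
    by (simp add: hypercube_char_def prod.distrib add.commute)
qed

text \<open>Serves twice: at \<open>\<rho>\<close> = 1 the kernel is a multiple of the indicator of
  x = y and Parseval follows; for \<open>\<rho>\<close> in (-1, 1), kernel and denominator together
  form the law of the correlated pair.\<close>

lemma sum_fourier_coeff:
  fixes F G :: "bit ^ 'n \<Rightarrow> real"
  shows "(\<Sum>S\<in>UNIV. fourier_coeff F S * fourier_coeff G S * \<rho> ^ card S) =
    (\<Sum>x\<in>UNIV. \<Sum>y\<in>UNIV. F x * G y *
      (\<Prod>i\<in>UNIV. 1 + \<rho> * (bit_sign (x $ i) * bit_sign (y $ i)))) / 4 ^ CARD('n)"
proof -
  have four: "(4 :: real) ^ CARD('n) = 2 ^ CARD('n) * 2 ^ CARD('n)"
    by (simp flip: power_mult_distrib)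
  have "(\<Sum>S\<in>UNIV. fourier_coeff F S * fourier_coeff G S * \<rho> ^ card S) =
     (\<Sum>S\<in>UNIV. \<Sum>x\<in>UNIV. \<Sum>y\<in>UNIV.
        F x * G y * (\<rho> ^ card S * (hypercube_char S x * hypercube_char S y))) / 4 ^ CARD('n)"
    unfolding fourier_coeff_def four sum_divide_distrib
    by (intro sum.cong refl, unfold times_divide_times_eq sum_product)
       (simp add: sum_distrib_left sum_divide_distrib mult_ac)
  also have "\<dots> = (\<Sum>x\<in>UNIV. \<Sum>y\<in>UNIV. \<Sum>S\<in>UNIV.
        F x * G y * (\<rho> ^ card S * (hypercube_char S x * hypercube_char S y))) / 4 ^ CARD('n)"
    by (subst sum.swap, subst sum.swap, rule refl)
  finally show ?thesis
    by (simp only: sum_distrib_left[symmetric] sum_hypercube_char)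
qed

lemma prod_bit_sign_eq:
  fixes x y :: "bit ^ 'n"
  shows "(\<Prod>i\<in>UNIV. 1 + bit_sign (x $ i) * bit_sign (y $ i)) = (if x = y then 2 ^ CARD('n) else 0)"
proof (cases "x = y")
  case True
  have "1 + bit_sign (y $ i) * bit_sign (y $ i) = 2" for i
    by (simp add: bit_sign_def)
  with True show ?thesis by simp
next
  case False
  then obtain i where "x $ i \<noteq> y $ i"
    by (auto simp: vec_eq_iff)
  then have "1 + bit_sign (x $ i) * bit_sign (y $ i) = 0"
    by (cases "x $ i"; cases "y $ i") (auto simp: bit_sign_def)
  with False show ?thesis
    by (auto simp: prod_zero_iff)
qed

lemma parseval:
  fixes F :: "bit ^ 'n \<Rightarrow> real"
  shows "(\<Sum>S\<in>UNIV. (fourier_coeff F S)\<^sup>2) = (\<Sum>x\<in>UNIV. (F x)\<^sup>2) / 2 ^ CARD('n)"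
proof -
  have four: "(4 :: real) ^ CARD('n) = 2 ^ CARD('n) * 2 ^ CARD('n)"
    by (simp flip: power_mult_distrib)
  show ?thesis
    using sum_fourier_coeff[of F F 1]
    by (simp add: prod_bit_sign_eq power2_eq_square four if_distrib cong: if_cong
        flip: sum_distrib_right)
qed

lemma parseval_sign:
  fixes F :: "bit ^ 'n \<Rightarrow> real"
  assumes "\<And>x. F x \<in> {-1, 1}"
  shows "(\<Sum>S\<in>UNIV. (fourier_coeff F S)\<^sup>2) = 1"
proof -
  have "(F x)\<^sup>2 = 1" for x
    using assms[of x] by auto
  then show ?thesis
    unfolding parseval by (simp add: card_bit)
qed

text \<open>Parseval gives total squared weight 1, which the coefficient at the empty set already
  exhausts.\<close>

lemma fourier_coeff_one:
  "fourier_coeff (\<lambda>_ :: bit ^ 'n. 1) S = (if S = {} then 1 else 0)"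
proof -
  let ?c = "fourier_coeff (\<lambda>_ :: bit ^ 'n. 1)"
  have empty: "?c {} = 1"
    by (simp add: fourier_coeff_def hypercube_char_def card_bit)
  have "(\<Sum>S\<in>UNIV. (?c S)\<^sup>2) = 1"
    by (rule parseval_sign) simp
  then have "(\<Sum>S\<in>UNIV - {{}}. (?c S)\<^sup>2) = 0"
    using empty by (simp add: sum.remove[of UNIV "{}"])
  then have "\<forall>S\<in>UNIV - {{}}. (?c S)\<^sup>2 = 0"
    by (subst (asm) sum_nonneg_eq_0_iff) auto
  with empty show ?thesis by auto
qed

text \<open>Bounding each |p q| by (p^2 + q^2) / 2 reduces the claim to Parseval for
  \<open>F\<close> and for \<open>G\<close>.\<close>

lemma sum_abs_fourier_coeff_le_1:
  fixes F G :: "bit ^ 'n \<Rightarrow> real"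
  assumes "\<And>x. F x \<in> {-1, 1}" "\<And>x. G x \<in> {-1, 1}"
  shows "(\<Sum>S\<in>A. \<bar>fourier_coeff F S * fourier_coeff G S\<bar>) \<le> 1"
proof -
  have le: "\<bar>p * q\<bar> \<le> (p\<^sup>2 + q\<^sup>2) / 2" for p q :: real
    using sum_squares_bound[of "\<bar>p\<bar>" "\<bar>q\<bar>"] by (simp add: abs_mult)
  have "(\<Sum>S\<in>A. \<bar>fourier_coeff F S * fourier_coeff G S\<bar>) \<le>
      (\<Sum>S\<in>UNIV. \<bar>fourier_coeff F S * fourier_coeff G S\<bar>)"
    by (intro sum_mono2) auto
  also have "\<dots> \<le> (\<Sum>S\<in>UNIV. ((fourier_coeff F S)\<^sup>2 + (fourier_coeff G S)\<^sup>2) / 2)"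
    by (intro sum_mono le)
  also have "\<dots> = 1"
    by (simp add: sum.distrib parseval_sign[OF assms(1)] parseval_sign[OF assms(2)]
        flip: sum_divide_distrib)
  finally show ?thesis .
qed

section \<open>The joint distribution of two Boolean functions\<close>

text \<open>Each coordinate of y contributes a factor with denominator 2, and the uniform choice of
  x contributes another 2^n.\<close>

lemma pmf_correlated_pair:
  fixes x y :: "bit ^ 'n"
  assumes "\<rho> \<in> {-1<..<1}"
  shows "pmf (correlated_pair \<rho>) (x, y) =
    (\<Prod>i\<in>UNIV. 1 + \<rho> * (bit_sign (x $ i) * bit_sign (y $ i))) / 4 ^ CARD('n)"
proof -
  define K where "K = (\<lambda>x :: bit ^ 'n. Pi_pmf UNIV 0
     (\<lambda>i. map_pmf (\<lambda>same. if same then x $ i else x $ i + 1) (bernoulli_pmf ((1 + \<rho>) / 2))))"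
  have corr: "correlated_pair \<rho> =
      bind_pmf (pmf_of_set UNIV) (\<lambda>x. map_pmf (\<lambda>y. (x, \<chi> i. y i)) (K x))"
    by (simp add: correlated_pair_def K_def map_pmf_def)
  have coord: "pmf (map_pmf (\<lambda>same. if same then a else a + 1) (bernoulli_pmf ((1 + \<rho>) / 2))) b =
      (1 + \<rho> * (bit_sign a * bit_sign b)) / 2" for a b :: bit
  proof -
    have inj: "inj (\<lambda>same. if same then a else a + 1)"
      by (auto simp: inj_def split: if_splits)
    \<comment> \<open>Exhibits the unique preimage of \<open>b\<close>, namely the truth value of b
      = a, so the mass can be read off by injectivity.\<close>
    have b: "b = (if b = a then a else a + 1)"
      by (cases a; cases b) auto
    have "pmf (map_pmf (\<lambda>same. if same then a else a + 1) (bernoulli_pmf ((1 + \<rho>) / 2))) b =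
        pmf (bernoulli_pmf ((1 + \<rho>) / 2)) (b = a)"
      by (subst b, rule pmf_map_inj'[OF inj])
    also have "\<dots> = (1 + \<rho> * (bit_sign a * bit_sign b)) / 2"
      using assms by (cases a; cases b) (auto simp: bit_sign_def field_simps)
    finally show ?thesis .
  qed
  have K: "pmf (K x) (($) y) = (\<Prod>i\<in>UNIV. (1 + \<rho> * (bit_sign (x $ i) * bit_sign (y $ i))) / 2)"
    unfolding K_def by (subst pmf_Pi') (simp_all only: coord finite UNIV_I simp_thms)
  have "pmf (map_pmf (\<lambda>y. (x', \<chi> i. y i)) (K x')) (x, y) =
      (if x' = x then (\<Prod>i\<in>UNIV. (1 + \<rho> * (bit_sign (x $ i) * bit_sign (y $ i))) / 2) else 0)" for x'
  proof (cases "x' = x")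
    case True
    have inj: "inj (\<lambda>y :: 'n \<Rightarrow> bit. (x, \<chi> i. y i))"
      by (auto simp: inj_def vec_eq_iff)
    show ?thesis
      using pmf_map_inj'[OF inj, of "K x" "($) y"] True K by simp
  next
    case False
    then show ?thesis
      by (auto intro!: pmf_map_outside)
  qed
  then show ?thesis
    unfolding corr
    by (subst pmf_bind_pmf_of_set)
       (auto simp: card_bit prod_dividef simp flip: power_mult_distrib)
qed

lemma sum_correlated_pair:
  fixes F G :: "bit ^ 'n \<Rightarrow> real"
  assumes "\<rho> \<in> {-1<..<1}"
  shows "(\<Sum>x\<in>UNIV. \<Sum>y\<in>UNIV. F x * G y * pmf (correlated_pair \<rho>) (x, y)) =
    (\<Sum>S\<in>UNIV. fourier_coeff F S * fourier_coeff G S * \<rho> ^ card S)"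
  unfolding sum_fourier_coeff pmf_correlated_pair[OF assms] sum_divide_distrib by simp

lemma pmf_joint_pmf:
  fixes f g :: "bit ^ 'n \<Rightarrow> int"
  assumes \<rho>: "\<rho> \<in> {-1<..<1}"
    and f: "range f \<subseteq> {-1, 1}" and g: "range g \<subseteq> {-1, 1}"
    and f0: "fourier_empty f = 0" and g0: "fourier_empty g = 0"
    and a: "a \<in> {-1, 1}" and b: "b \<in> {-1, 1}"
  shows "pmf (joint_pmf f g \<rho>) (a, b) =
    (1 + a * b * (\<Sum>S\<in>- {{}}. fourier_coeff f S * fourier_coeff g S * \<rho> ^ card S)) / 4"
proof -
  let ?p = "\<lambda>x y :: bit ^ 'n. pmf (correlated_pair \<rho>) (x, y)"
  let ?E = "\<lambda>F G. \<Sum>x\<in>UNIV. \<Sum>y\<in>UNIV. F x * G y * ?p x y"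
  have f_empty: "fourier_coeff f {} = 0" and g_empty: "fourier_coeff g {} = 0"
    using f0 g0 by (simp_all add: fourier_coeff_def fourier_empty_def hypercube_char_def)
  \<comment> \<open>When one factor is the constant 1, only S = {} survives, so this and the next
    two expectations reduce to coefficients at the empty set.\<close>
  have E1: "?E (\<lambda>_. 1) (\<lambda>_. 1) = 1"
    unfolding sum_correlated_pair[OF \<rho>] fourier_coeff_one
    by (simp add: sum.remove[of UNIV "{}"])
  have Ef: "?E f (\<lambda>_. 1) = 0"
    unfolding sum_correlated_pair[OF \<rho>] fourier_coeff_one
    using f_empty by (simp add: sum.remove[of UNIV "{}"])
  have Eg: "?E (\<lambda>_. 1) g = 0"
    unfolding sum_correlated_pair[OF \<rho>] fourier_coeff_one
    using g_empty by (simp add: sum.remove[of UNIV "{}"])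
  have Efg: "?E f g = (\<Sum>S\<in>- {{}}. fourier_coeff f S * fourier_coeff g S * \<rho> ^ card S)"
    unfolding sum_correlated_pair[OF \<rho>] using f_empty
    by (simp add: sum.remove[of UNIV "{}"] Compl_eq_Diff_UNIV)
  \<comment> \<open>For signs a and s, (1 + a s) / 2 is the indicator of s = a.\<close>
  have ind: "of_bool (f x = a \<and> g y = b) = (1 + a * real_of_int (f x)) * (1 + b * real_of_int (g y)) / 4" for x y
    using a b subsetD[OF f rangeI[of f x]] subsetD[OF g rangeI[of g y]] by auto
  \<comment> \<open>The explicit factors 1 give every summand the shape of \<open>?E\<close>, with a
    constant function in place of f or g.\<close>
  have expand: "(1 + a' * s) * (1 + b' * t) / 4 * p =
      (1 * 1 * p + a' * (s * 1 * p) + b' * (1 * t * p) + a' * b' * (s * t * p)) / 4" for a' b' s t p :: real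
    by (simp add: algebra_simps)
  have "pmf (joint_pmf f g \<rho>) (a, b) = (\<Sum>(x, y)\<in>UNIV. of_bool (f x = a \<and> g y = b) * ?p x y)"
    unfolding joint_pmf_def pmf_map
    by (subst measure_measure_pmf_finite) (auto simp: vimage_def intro!: sum.mono_neutral_cong_left)
  also have "\<dots> = (\<Sum>x\<in>UNIV. \<Sum>y\<in>UNIV. of_bool (f x = a \<and> g y = b) * ?p x y)"
    by (simp only: sum.cartesian_product UNIV_Times_UNIV)
  also have "\<dots> = (?E (\<lambda>_. 1) (\<lambda>_. 1) + a * ?E f (\<lambda>_. 1) + b * ?E (\<lambda>_. 1) g + a * b * ?E f g) / 4"
    unfolding ind expand by (simp only: sum.distrib sum_distrib_left sum_divide_distrib add_divide_distrib of_int_mult)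
  finally show ?thesis
    unfolding E1 Ef Eg Efg by simp
qed

text \<open>The summand depends only on the product of the two signs; the two pairs with equal signs
  yield one term of the binary divergence, the other two yield the other.\<close>

lemma KL_joint_pmf_eq_binary_KL:
  assumes \<rho>: "\<rho>\<^sub>0 \<in> {-1<..<1}" "\<rho>\<^sub>1 \<in> {-1<..<1}"
    and f: "range f \<subseteq> {-1, 1}" and g: "range g \<subseteq> {-1, 1}"
    and u: "\<And>a b. a \<in> {-1, 1} \<Longrightarrow> b \<in> {-1, 1} \<Longrightarrow> pmf (joint_pmf f g \<rho>\<^sub>0) (a, b) = (1 + a * b * u) / 4"
    and v: "\<And>a b. a \<in> {-1, 1} \<Longrightarrow> b \<in> {-1, 1} \<Longrightarrow> pmf (joint_pmf f g \<rho>\<^sub>1) (a, b) = (1 + a * b * v) / 4"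
  shows "KL_pmf (joint_pmf f g \<rho>\<^sub>0) (joint_pmf f g \<rho>\<^sub>1) = binary_KL ((1 + u) / 2) ((1 + v) / 2)"
proof -
  have quarter: "x / 4 / (y / 4) = x / y" for x y :: real
    by simp
  let ?t = "\<lambda>z. pmf (joint_pmf f g \<rho>\<^sub>0) z * ln (pmf (joint_pmf f g \<rho>\<^sub>0) z / pmf (joint_pmf f g \<rho>\<^sub>1) z)"
  have t: "?t (a, b) = (1 + a * b * u) * ln ((1 + a * b * u) / (1 + a * b * v)) / 4"
    if "a \<in> {-1, 1}" "b \<in> {-1, 1}" for a b
    unfolding u[OF that] v[OF that] quarter by simp
  have "KL_pmf (joint_pmf f g \<rho>\<^sub>0) (joint_pmf f g \<rho>\<^sub>1) = (\<Sum>z\<in>range f \<times> range g. ?t z)"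
    by (rule KL_pmf_joint_pmf[OF \<rho>])
  \<comment> \<open>Sign pairs outside the support have mass 0 and add nothing.\<close>
  also have "\<dots> = (\<Sum>z\<in>{-1, 1} \<times> {-1, 1}. ?t z)"
    using f g by (intro sum.mono_neutral_left)
      (auto simp: set_joint_pmf[OF \<rho>(1)] simp flip: set_pmf_iff)
  also have "\<dots> = binary_KL ((1 + u) / 2) ((1 + v) / 2)"
    using t[of 1 1] t[of 1 "-1"] t[of "-1" 1] t[of "-1" "-1"] unfolding binary_KL_half
    by (simp add: sum.cartesian_product' add_divide_distrib distrib_right)
  finally show ?thesis .
qed

theorem theorem1:
  fixes f g :: "bit ^ 'n \<Rightarrow> int" and \<rho>\<^sub>0 \<rho>\<^sub>1 :: real
  assumes "\<rho>\<^sub>0 \<in> {-1<..<1}" and "\<rho>\<^sub>1 \<in> {-1<..<1}"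
    and "range f \<subseteq> {-1, 1}" and "range g \<subseteq> {-1, 1}"
    and "fourier_empty f = 0" and "fourier_empty g = 0"
  shows "KL_pmf (joint_pmf f g \<rho>\<^sub>0) (joint_pmf f g \<rho>\<^sub>1)
    \<le> (MAX k\<in>{1..CARD('n)}. binary_KL ((1 + \<rho>\<^sub>0 ^ k) / 2) ((1 + \<rho>\<^sub>1 ^ k) / 2))"
    (is "_ \<le> ?M")
proof -
  let ?w = "\<lambda>S. fourier_coeff f S * fourier_coeff g S"
  let ?\<theta> = "\<lambda>\<rho>. \<Sum>S\<in>- {{}}. ?w S * \<rho> ^ card S"
  have power_less: "\<bar>\<rho> ^ k\<bar> < 1" if "\<rho> \<in> {-1<..<1}" "k > 0" for \<rho> :: real and k
    using that by (simp add: power_abs power_less_one_iff abs_less_iff)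
  \<comment> \<open>Removing the empty set, which unbiasedness permits, excludes the exponent 0,
    where the power would be 1 and the strict bound would fail.\<close>
  have card_S: "card S \<in> {1..CARD('n)}" if "S \<in> - {{}}" for S :: "'n set"
    using that by (auto simp: Suc_le_eq card_gt_0_iff intro: card_mono)
  have le_M: "binary_KL ((1 + \<rho>\<^sub>0 ^ k) / 2) ((1 + \<rho>\<^sub>1 ^ k) / 2) \<le> ?M" if "k \<in> {1..CARD('n)}" for k
    using that by (intro Max_ge) auto
  \<comment> \<open>The exponent 1 always occurs in the maximum, so \<open>?M\<close> is
    nonnegative, as needed when the weights sum to less than 1.\<close>
  have "0 \<le> binary_KL ((1 + \<rho>\<^sub>0 ^ 1) / 2) ((1 + \<rho>\<^sub>1 ^ 1) / 2)"
    using assms(1,2) by (intro binary_KL_half_nonneg power_less) auto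
  also have "\<dots> \<le> ?M"
    by (rule le_M) (simp add: Suc_le_eq)
  finally have "?M \<ge> 0" .
  have signs: "real_of_int (f x) \<in> {-1, 1}" "real_of_int (g x) \<in> {-1, 1}" for x
    using subsetD[OF assms(3) rangeI[of f x]] subsetD[OF assms(4) rangeI[of g x]] by auto
  have "KL_pmf (joint_pmf f g \<rho>\<^sub>0) (joint_pmf f g \<rho>\<^sub>1) =
      binary_KL ((1 + ?\<theta> \<rho>\<^sub>0) / 2) ((1 + ?\<theta> \<rho>\<^sub>1) / 2)"
    by (intro KL_joint_pmf_eq_binary_KL pmf_joint_pmf assms)
  also have "\<dots> \<le> ?M"
  \<comment> \<open>The weights \<open>?w S\<close> do not involve \<open>\<rho>\<close>, so the
    same combination of powers yields both arguments.\<close>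
  proof (rule binary_KL_half_abs_convex)
    show "(\<Sum>S\<in>- {{}}. \<bar>?w S\<bar>) \<le> 1"
      by (rule sum_abs_fourier_coeff_le_1) (fact signs)+
    show "\<bar>\<rho>\<^sub>0 ^ card S\<bar> < 1" "\<bar>\<rho>\<^sub>1 ^ card S\<bar> < 1" if "S \<in> - {{}}" for S :: "'n set"
      using card_S[OF that] assms(1,2) by (auto intro!: power_less)
    show "binary_KL ((1 + \<rho>\<^sub>0 ^ card S) / 2) ((1 + \<rho>\<^sub>1 ^ card S) / 2) \<le> ?M"
      if "S \<in> - {{}}" for S :: "'n set"
      using card_S[OF that] by (rule le_M)
  qed (use \<open>?M \<ge> 0\<close> in auto)
  finally show ?thesis .
qed

end
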